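(* Let $\phi$ be the Laplace exponent of a subordinator and let $H(\lambda)=\phi(\lambda)-\lambda\phi'(\lambda)$. (1) If $H$ satisfies (L) with constants $\gamma,\lambda_L,C_L$ and (U) with constants $\delta,\lambda_U,C_U$ where $\delta<2$, then there exists a constant $M\in(0,1)$ such that $$\lambda\phi'(\lambda)\asymp\phi(\lambda),\qquad\lambda>\lambda_L\vee M^{-1}\lambda_U.$$ (2) Conversely, if $\lambda_L\ge0$ and $\lambda\phi'(\lambda)\asymp\phi(\lambda)$, $\lambda>\lambda_L$, then $\phi$ satisfies the lower scaling condition (L).
   Context: The Laplace exponent of a subordinator $S$ (an increasing $[0,\infty)$-valued Lévy process started at $0$) is the function $\phi$ with $\mathbb{E}e^{-\lambda S_t}=e^{-t\phi(\lambda)}$, $\lambda>0$; it has the form $\phi(\lambda)=b\lambda+\int_{(0,\infty)}(1-e^{-\lambda s})\mu(ds)$ with drift $b\ge0$ and Lévy measure $\mu$ on $(0,\infty)$, $\int_{(0,\infty)}(1\wedge s)\mu(ds)<\infty$. Scaling conditions concern functions with values in $(0,\infty)$, so $\phi$ is understood to be not identically zero. Scaling conditions for $f:(0,\infty)\to(0,\infty)$. (L): there exist $\gamma>0$, $\lambda_L\ge0$, $C_L>0$ such that $f(\lambda x)/f(\lambda)\ge C_Lx^\gamma$ for all $\lambda>\lambda_L$, $x\ge1$. (U): there exist $\delta>0$, $\lambda_U\ge0$, $C_U>0$ such that $f(\lambda x)/f(\lambda)\le C_Ux^\delta$ for all $\lambda>\lambda_U$, $x\ge1$. $a\vee b=\max\{a,b\}$.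 $f(\lambda)\asymp g(\lambda)$, $\lambda\in I$, means there exist constants $c_1,c_2>0$ with $c_1f(\lambda)\le g(\lambda)\le c_2f(\lambda)$ for all $\lambda\in I$. *)

theory Defs
  imports "HOL-Probability.Probability"
begin

text \<open>
  Time is \<open>[0, \<infinity>)\<close>: only the values \<open>X t\<close> with \<open>t \<ge> 0\<close> are constrained, and
  path properties are required almost surely.
\<close>

locale levy_process = prob_space P
  for P :: "'a measure" +
  fixes X :: "real \<Rightarrow> 'a \<Rightarrow> real"
  assumes random_variable: "t \<ge> 0 \<Longrightarrow> X t \<in> borel_measurable P"
    and starts_at_zero: "AE \<omega> in P. X 0 \<omega> = 0"
    and independent_increments:
      "\<And>(n::nat) (t::nat \<Rightarrow> real). 0 \<le> t 0 \<Longrightarrow> (\<And>i. i < n \<Longrightarrow> t i < t (Suc i)) \<Longrightarrow>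
         indep_vars (\<lambda>_. borel) (\<lambda>i \<omega>. X (t (Suc i)) \<omega> - X (t i) \<omega>) {..<n}"
    and stationary_increments:
      "s \<ge> 0 \<Longrightarrow> t \<ge> 0 \<Longrightarrow>
         distr P borel (\<lambda>\<omega>. X (s + t) \<omega> - X s \<omega>) = distr P borel (X t)"
    and right_continuous_paths:
      "AE \<omega> in P. \<forall>t\<ge>0. continuous (at_right t) (\<lambda>s. X s \<omega>)"
    and left_limits:
      "AE \<omega> in P. \<forall>t>0. \<exists>l. ((\<lambda>s. X s \<omega>) \<longlongrightarrow> l) (at_left t)"

locale subordinator = levy_process P S
  for P :: "'a measure" and S :: "real \<Rightarrow> 'a \<Rightarrow> real" +
  assumes nonneg_valued: "AE \<omega> in P. \<forall>t\<ge>0. S t \<omega> \<ge> 0"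
    and increasing_paths: "AE \<omega> in P. mono_on {0..} (\<lambda>t. S t \<omega>)"

text \<open>Only the values of \<open>\<phi>\<close> on \<open>(0, \<infinity>)\<close> matter.\<close>

definition laplace_exponent ::
    "'a measure \<Rightarrow> (real \<Rightarrow> 'a \<Rightarrow> real) \<Rightarrow> (real \<Rightarrow> real) \<Rightarrow> bool" where
  "laplace_exponent P S \<phi> \<longleftrightarrow>
     (\<forall>t\<ge>0. \<forall>l>0. (\<integral>\<omega>. exp (- l * S t \<omega>) \<partial>P) = exp (- t * \<phi> l))"

text \<open>
  The scaling conditions are conditions on functions \<open>(0, \<infinity>) \<rightarrow> (0, \<infinity>)\<close>, so
  positivity on \<open>(0, \<infinity>)\<close> is part of them. The arguments are the exponent, the
  threshold and the multiplicative constant.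
\<close>

definition lower_scaling :: "(real \<Rightarrow> real) \<Rightarrow> real \<Rightarrow> real \<Rightarrow> real \<Rightarrow> bool" where
  "lower_scaling f \<gamma> l\<^sub>L C\<^sub>L \<longleftrightarrow>
     f \<in> {0<..} \<rightarrow> {0<..} \<and> \<gamma> > 0 \<and> l\<^sub>L \<ge> 0 \<and> C\<^sub>L > 0 \<and>
     (\<forall>l>l\<^sub>L. \<forall>x\<ge>1. f (l * x) / f l \<ge> C\<^sub>L * x powr \<gamma>)"

definition upper_scaling :: "(real \<Rightarrow> real) \<Rightarrow> real \<Rightarrow> real \<Rightarrow> real \<Rightarrow> bool" where
  "upper_scaling f \<delta> l\<^sub>U C\<^sub>U \<longleftrightarrow>
     f \<in> {0<..} \<rightarrow> {0<..} \<and> \<delta> > 0 \<and> l\<^sub>U \<ge> 0 \<and> C\<^sub>U > 0 \<and>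
     (\<forall>l>l\<^sub>U. \<forall>x\<ge>1. f (l * x) / f l \<le> C\<^sub>U * x powr \<delta>)"

definition comparable_on :: "real set \<Rightarrow> (real \<Rightarrow> real) \<Rightarrow> (real \<Rightarrow> real) \<Rightarrow> bool" where
  "comparable_on I f g \<longleftrightarrow>
     (\<exists>c\<^sub>1>0. \<exists>c\<^sub>2>0. \<forall>l\<in>I. c\<^sub>1 * f l \<le> g l \<and> g l \<le> c\<^sub>2 * f l)"

end

(*
  Only time 1 matters: phi = -ln L with L(x) = E exp(-x S_1), and phi is concave with slope
  g(x) = E[S_1 exp(-x S_1)] / L(x).  Concavity gives
    H(K x) - H(x) <= phi(K x) - phi(x) + x phi'(x) <= K x phi'(x)   for K >= 1.
  Under (L) one can pick K with H(K x) >= 2 H(x), so phi(x) = H(x) + x phi'(x) <= (K + 1) x phi'(x).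
  Hence part (1) holds with any M in (0,1).  For part (2), phi(x) <= c x phi'(x) says that
  ln phi(x) - (ln x) / c has nonnegative derivative.
*)
theory Submission
  imports Defs
begin

section \<open>Differentiability from supergradients, and an elementary bound\<close>

text \<open>The difference quotient at \<open>x\<close> is squeezed between \<open>g x\<close> and
  \<open>g y\<close>, and these merge by continuity. This gives the derivative of
  \<open>\<phi>\<close> without differentiating under the expectation.\<close>

lemma has_real_derivative_of_continuous_supergradient:
  fixes f g :: "real \<Rightarrow> real"
  assumes U: "open U" "x \<in> U"
    and supergradient: "\<And>x y. x \<in> U \<Longrightarrow> y \<in> U \<Longrightarrow> f y \<le> f x + (y - x) * g x"
    and cont: "continuous_on U g"
  shows "(f has_real_derivative g x) (at x)"
proof -
  have "(g \<longlongrightarrow> g x) (at x)"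
    using cont U by (simp add: continuous_on_eq_continuous_at isCont_def)
  then have lim: "((\<lambda>y. \<bar>g y - g x\<bar>) \<longlongrightarrow> 0) (at x)"
    by (simp add: LIM_zero_iff tendsto_rabs_zero_iff)
  have "((\<lambda>y. (f y - f x) / (y - x) - g x) \<longlongrightarrow> 0) (at x)"
  proof (rule Lim_null_comparison[OF _ lim])
    have "norm ((f y - f x) / (y - x) - g x) \<le> \<bar>g y - g x\<bar>" if "y \<in> U" "y \<noteq> x" for y
    proof -
      \<comment> \<open>The first bound is the supergradient at \<open>x\<close> tested at
        \<open>y\<close>, the second the one at \<open>y\<close> tested at \<open>x\<close>.\<close>
      have "f y - f x - (y - x) * g x \<le> 0" "f y - f x - (y - x) * g x \<ge> (y - x) * (g y - g x)"
        using supergradient[OF U(2) that(1)] supergradient[OF that(1) U(2)]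
        by (auto simp: algebra_simps)
      then have "\<bar>f y - f x - (y - x) * g x\<bar> \<le> \<bar>(y - x) * (g y - g x)\<bar>"
        by linarith
      moreover have "(f y - f x) / (y - x) - g x = (f y - f x - (y - x) * g x) / (y - x)"
        using that by (simp add: field_simps)
      ultimately show ?thesis
        using that by (simp add: abs_mult abs_divide divide_le_eq mult.commute)
    qed
    then show "\<forall>\<^sub>F y in at x. norm ((f y - f x) / (y - x) - g x) \<le> \<bar>g y - g x\<bar>"
      unfolding eventually_at_topological using U by blast
  qed
  then show ?thesis
    by (simp add: has_field_derivative_iff LIM_zero_iff)
qed

text \<open>Uniform in \<open>s\<close>, so it makes \<open>X * exp (- x * X)\<close> integrable
  without any moment assumption on \<open>X\<close>.\<close>

lemma mult_exp_minus_le: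
  fixes x s :: real
  assumes "x > 0"
  shows "s * exp (- x * s) \<le> 1 / x"
proof -
  have "x * s \<le> exp (x * s)"
    using exp_ge_add_one_self[of "x * s"] by linarith
  then show ?thesis
    using assms by (simp add: exp_minus field_simps)
qed

section \<open>Laplace transform of a nonnegative random variable\<close>

context prob_space
begin

context
  fixes X :: "'a \<Rightarrow> real"
  assumes X_measurable [measurable]: "X \<in> borel_measurable M"
    and X_nonneg: "AE \<omega> in M. X \<omega> \<ge> 0"
begin

lemma integrable_exp_minus:
  assumes "x > 0"
  shows "integrable M (\<lambda>\<omega>. exp (- x * X \<omega>))"
proof (rule integrable_const_bound[where B = 1])
  show "AE \<omega> in M. norm (exp (- x * X \<omega>)) \<le> 1"
    using X_nonneg by eventually_elim (use assms in simp)
qed measurable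

lemma integrable_mult_exp_minus:
  assumes "x > 0"
  shows "integrable M (\<lambda>\<omega>. X \<omega> * exp (- x * X \<omega>))"
proof (rule integrable_const_bound[where B = "1 / x"])
  show "AE \<omega> in M. norm (X \<omega> * exp (- x * X \<omega>)) \<le> 1 / x"
    using X_nonneg by eventually_elim (use mult_exp_minus_le[OF assms] in simp)
qed measurable

lemma continuous_on_laplace_transform:
  "continuous_on {0<..} (\<lambda>x. expectation (\<lambda>\<omega>. exp (- x * X \<omega>)))"
  unfolding continuous_on_sequentially comp_def
proof (intro allI ballI impI, elim conjE)
  fix u :: "nat \<Rightarrow> real" and x :: real
  assume u: "\<forall>n. u n \<in> {0<..}" "u \<longlonglongrightarrow> x"
  show "(\<lambda>n. expectation (\<lambda>\<omega>. exp (- u n * X \<omega>))) \<longlonglongrightarrow> expectation (\<lambda>\<omega>. exp (- x * X \<omega>))"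
  proof (rule integral_dominated_convergence[where w = "\<lambda>_. 1"])
    show "AE \<omega> in M. (\<lambda>n. exp (- u n * X \<omega>)) \<longlonglongrightarrow> exp (- x * X \<omega>)"
      by (intro AE_I2 tendsto_intros u)
    show "AE \<omega> in M. norm (exp (- u n * X \<omega>)) \<le> 1" for n
      using X_nonneg by eventually_elim (use u in \<open>simp add: less_imp_le\<close>)
  qed auto
qed

lemma continuous_on_laplace_transform_mult:
  "continuous_on {0<..} (\<lambda>x. expectation (\<lambda>\<omega>. X \<omega> * exp (- x * X \<omega>)))"
proof -
  let ?D = "\<lambda>x. expectation (\<lambda>\<omega>. X \<omega> * exp (- x * X \<omega>))"
  \<comment> \<open>The dominating constant \<open>1 / a\<close> blows up at 0, so continuity is
    first shown on each \<open>{a<..}\<close> and then at each \<open>x\<close> by taking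
    \<open>a = x/2\<close>.\<close>
  have "continuous_on {a<..} ?D" if "a > 0" for a
    unfolding continuous_on_sequentially comp_def
  proof (intro allI ballI impI, elim conjE)
    fix u :: "nat \<Rightarrow> real" and x :: real
    assume u: "\<forall>n. u n \<in> {a<..}" "u \<longlonglongrightarrow> x"
    show "(\<lambda>n. ?D (u n)) \<longlonglongrightarrow> ?D x"
    proof (rule integral_dominated_convergence[where w = "\<lambda>_. 1 / a"])
      show "AE \<omega> in M. (\<lambda>n. X \<omega> * exp (- u n * X \<omega>)) \<longlonglongrightarrow> X \<omega> * exp (- x * X \<omega>)"
        by (intro AE_I2 tendsto_intros u)
      show "AE \<omega> in M. norm (X \<omega> * exp (- u n * X \<omega>)) \<le> 1 / a" for n
        using X_nonneg
      proof eventually_elim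
        case (elim \<omega>)
        have "u n > a" using u by simp
        then have "X \<omega> * exp (- u n * X \<omega>) \<le> 1 / u n" "1 / u n \<le> 1 / a"
          using \<open>a > 0\<close> mult_exp_minus_le[of "u n" "X \<omega>"] by (auto simp: frac_le)
        with elim show ?case by simp
      qed
    qed auto
  qed
  then have "isCont ?D x" if "x > 0" for x
    using that continuous_on_interior[of "{x/2<..}" ?D x] by (simp add: interior_open)
  then show ?thesis
    by (simp add: continuous_at_imp_continuous_on)
qed

lemma laplace_transform_pos:
  assumes "x > 0"
  shows "expectation (\<lambda>\<omega>. exp (- x * X \<omega>)) > 0"
  using integral_less_AE_space[of "\<lambda>_. 0" "\<lambda>\<omega>. exp (- x * X \<omega>)"] integrable_exp_minus[OF assms]
  by (simp add: emeasure_space_1)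

lemma laplace_transform_le_1:
  assumes "x > 0"
  shows "expectation (\<lambda>\<omega>. exp (- x * X \<omega>)) \<le> 1"
proof -
  have "expectation (\<lambda>\<omega>. exp (- x * X \<omega>)) \<le> expectation (\<lambda>_. 1)"
  proof (rule integral_mono_AE)
    show "AE \<omega> in M. exp (- x * X \<omega>) \<le> 1"
      using X_nonneg by eventually_elim (use assms in simp)
  qed (use integrable_exp_minus[OF assms] in auto)
  then show ?thesis by (simp add: prob_space)
qed

text \<open>Jensen's inequality for \<open>exp\<close> under the tilted law with density \<open>exp (- x * X) / L x\<close>.\<close>

lemma laplace_transform_log_convex:
  assumes "x > 0" "y > 0"
  defines "L \<equiv> \<lambda>x. expectation (\<lambda>\<omega>. exp (- x * X \<omega>))"
    and "D \<equiv> \<lambda>x. expectation (\<lambda>\<omega>. X \<omega> * exp (- x * X \<omega>))"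
  shows "L x * exp (- (y - x) * (D x / L x)) \<le> L y"
proof -
  \<comment> \<open>The mean of \<open>- (y - x) * X\<close> under the tilted law.\<close>
  define a where "a = - (y - x) * (D x / L x)"
  have L: "L x > 0"
    using laplace_transform_pos[OF assms(1)] by (simp add: L_def)
  note [simp] = integrable_exp_minus[OF assms(1), simplified]
    integrable_mult_exp_minus[OF assms(1), simplified]
    integrable_exp_minus[OF assms(2), simplified]
  have "exp a * ((1 - a) * exp (- x * X \<omega>) - (y - x) * (X \<omega> * exp (- x * X \<omega>)))
          \<le> exp (- y * X \<omega>)" for \<omega>
  proof -
    let ?u = "- (y - x) * X \<omega>"
    \<comment> \<open>The tangent line of \<open>exp\<close> at \<open>a\<close> bounds
      \<open>exp ?u\<close> from below; it is weighted by the tilting factor.\<close>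
    have "exp a * exp (- x * X \<omega>) * (1 + (?u - a)) \<le> exp a * exp (- x * X \<omega>) * exp (?u - a)"
      by (intro mult_left_mono exp_ge_add_one_self) simp
    also have "\<dots> = exp (- y * X \<omega>)"
      by (simp add: exp_add[symmetric] algebra_simps)
    finally show ?thesis
      by (simp add: algebra_simps)
  qed
  then have "expectation (\<lambda>\<omega>. exp a * ((1 - a) * exp (- x * X \<omega>) - (y - x) * (X \<omega> * exp (- x * X \<omega>)))) \<le> L y"
    unfolding L_def by (intro integral_mono) auto
  also have "expectation (\<lambda>\<omega>. exp a * ((1 - a) * exp (- x * X \<omega>) - (y - x) * (X \<omega> * exp (- x * X \<omega>))))
      = exp a * ((1 - a) * L x - (y - x) * D x)"
    by (simp add: L_def D_def)
  \<comment> \<open>The linear term integrates to zero because \<open>a\<close> is the tilted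
    mean.\<close>
  also have "(1 - a) * L x - (y - x) * D x = L x"
    using L by (simp add: a_def field_simps)
  finally show ?thesis
    by (simp add: a_def mult.commute)
qed

end

end

section \<open>Concavity and regularity of the Laplace exponent\<close>

text \<open>Minus the logarithm of the inequality \<open>laplace_transform_log_convex\<close> for
  \<open>S 1\<close> is the supergradient inequality. The slope \<open>g x\<close> is the mean of
  \<open>S 1\<close> under the tilted law; it is kept apart from \<open>deriv \<phi>\<close> because
  differentiability is only derived from it afterwards.\<close>

lemma laplace_exponent_concave:
  assumes "subordinator P S" and "laplace_exponent P S \<phi>"
  obtains g where "continuous_on {0<..} g"
    and "\<And>x. x > 0 \<Longrightarrow> g x \<ge> 0" and "\<And>x. x > 0 \<Longrightarrow> \<phi> x \<ge> 0"
    and "\<And>x y. x > 0 \<Longrightarrow> y > 0 \<Longrightarrow> \<phi> y \<le> \<phi> x + (y - x) * g x"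
proof -
  interpret subordinator P S by fact
  have meas: "S 1 \<in> borel_measurable P"
    by (simp add: random_variable)
  have nonneg: "AE \<omega> in P. S 1 \<omega> \<ge> 0"
    using nonneg_valued by eventually_elim simp
  define L where "L x = expectation (\<lambda>\<omega>. exp (- x * S 1 \<omega>))" for x
  define D where "D x = expectation (\<lambda>\<omega>. S 1 \<omega> * exp (- x * S 1 \<omega>))" for x
  have L: "L x = exp (- \<phi> x)" if "x > 0" for x
    using assms(2) that unfolding laplace_exponent_def L_def by (metis mult_1 mult_minus_left zero_le_one)
  show ?thesis
  proof
    show "continuous_on {0<..} (\<lambda>x. D x / L x)"
    proof (rule continuous_on_divide)
      show "continuous_on {0<..} D"
        using continuous_on_laplace_transform_mult[OF meas nonneg] by (simp add: D_def)
      show "continuous_on {0<..} L"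
        using continuous_on_laplace_transform[OF meas nonneg] by (simp add: L_def)
    qed (simp add: L)
    \<comment> \<open>Valid for every real \<open>x\<close>: a non-integrable integrand has integral
      0 by convention.\<close>
    have "D x \<ge> 0" for x
      unfolding D_def by (rule integral_nonneg_AE) (use nonneg in auto)
    then show "D x / L x \<ge> 0" if "x > 0" for x
      using that by (simp add: L)
    show "\<phi> x \<ge> 0" if "x > 0" for x
      using laplace_transform_le_1[OF meas nonneg that] L[OF that] by (simp add: L_def)
    show "\<phi> y \<le> \<phi> x + (y - x) * (D x / L x)" if "x > 0" "y > 0" for x y
    proof -
      define q where "q = D x / L x"
      have "L x * exp (- (y - x) * q) \<le> L y"
        using laplace_transform_log_convex[OF meas nonneg that] by (simp add: L_def D_def q_def)
      then have "exp (- \<phi> x + - (y - x) * q) \<le> exp (- \<phi> y)"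
        by (simp only: L[OF that(1)] L[OF that(2)] exp_add)
      then show ?thesis by (simp add: q_def[symmetric] algebra_simps)
    qed
  qed
qed

text \<open>Continuity of \<open>g\<close> identifies it with \<open>deriv \<phi>\<close>. Strict
  positivity follows from concavity: a nonnegative concave function on the half-line that vanishes
  at one point has a horizontal tangent there and so vanishes everywhere.\<close>

lemma laplace_exponent_regularity:
  assumes "subordinator P S" and "laplace_exponent P S \<phi>" and "\<exists>l>0. \<phi> l \<noteq> 0"
  shows "\<And>x. x > 0 \<Longrightarrow> (\<phi> has_real_derivative deriv \<phi> x) (at x)"
    and "\<And>x. x > 0 \<Longrightarrow> deriv \<phi> x \<ge> 0" and "\<And>x. x > 0 \<Longrightarrow> \<phi> x > 0"
    and "\<And>x y. x > 0 \<Longrightarrow> y > 0 \<Longrightarrow> \<phi> y \<le> \<phi> x + (y - x) * deriv \<phi> x"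
proof -
  obtain g where g: "continuous_on {0<..} g" "\<And>x. x > 0 \<Longrightarrow> g x \<ge> 0" "\<And>x. x > 0 \<Longrightarrow> \<phi> x \<ge> 0"
    and tangent: "\<And>x y. x > 0 \<Longrightarrow> y > 0 \<Longrightarrow> \<phi> y \<le> \<phi> x + (y - x) * g x"
    using laplace_exponent_concave[OF assms(1,2)] by blast
  have der: "(\<phi> has_real_derivative g x) (at x)" if "x > 0" for x
    by (rule has_real_derivative_of_continuous_supergradient[of "{0<..}"]) (use g tangent that in auto)
  then have deriv: "deriv \<phi> x = g x" if "x > 0" for x
    using that by (blast intro: DERIV_imp_deriv)
  show "(\<phi> has_real_derivative deriv \<phi> x) (at x)" "deriv \<phi> x \<ge> 0" if "x > 0" for x
    using that der g by (auto simp: deriv)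
  show "\<phi> y \<le> \<phi> x + (y - x) * deriv \<phi> x" if "x > 0" "y > 0" for x y
    using that tangent by (simp add: deriv)
  show "\<phi> x > 0" if x: "x > 0" for x
  proof (rule ccontr)
    assume "\<not> \<phi> x > 0"
    with g(3)[OF x] have zero: "\<phi> x = 0" by simp
    \<comment> \<open>Testing the tangent at the zero \<open>x\<close> to the left of it, at
      \<open>x / 2\<close>, forces its slope to be at most 0.\<close>
    have "0 \<le> \<phi> (x / 2)" "\<phi> (x / 2) \<le> - (x / 2) * g x"
      using g(3)[of "x / 2"] tangent[of x "x / 2"] x zero by auto
    then have "x * g x \<le> 0"
      by simp
    then have "g x = 0"
      using g(2)[OF x] x by (simp add: mult_le_0_iff)
    then have "\<phi> y = 0" if "y > 0" for y
      using tangent[OF x that] g(3)[OF that] zero by simp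
    with assms(3) show False by blast
  qed
qed

section \<open>Scaling of \<open>H\<close> and \<open>\<phi>\<close> against comparability\<close>

theorem proposition2p10:
  fixes P :: "'a measure" and S :: "real \<Rightarrow> 'a \<Rightarrow> real" and \<phi> H :: "real \<Rightarrow> real"
  assumes "subordinator P S"
    and "laplace_exponent P S \<phi>"
    and "\<exists>l>0. \<phi> l \<noteq> 0"
    and "\<And>l. l > 0 \<Longrightarrow> H l = \<phi> l - l * deriv \<phi> l"
  shows "(\<forall>\<gamma> l\<^sub>L C\<^sub>L \<delta> l\<^sub>U C\<^sub>U.
            lower_scaling H \<gamma> l\<^sub>L C\<^sub>L \<and> upper_scaling H \<delta> l\<^sub>U C\<^sub>U \<and> \<delta> < 2 \<longrightarrow>
            (\<exists>M. 0 < M \<and> M < 1 \<and>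
               comparable_on {max l\<^sub>L (inverse M * l\<^sub>U)<..} (\<lambda>l. l * deriv \<phi> l) \<phi>)) \<and>
         (\<forall>l\<^sub>L\<ge>0. comparable_on {l\<^sub>L<..} (\<lambda>l. l * deriv \<phi> l) \<phi> \<longrightarrow>
            (\<exists>\<gamma> C\<^sub>L. lower_scaling \<phi> \<gamma> l\<^sub>L C\<^sub>L))"
proof -
  note \<phi> = laplace_exponent_regularity[OF assms(1-3)]
  show ?thesis
  proof (intro conjI allI impI)
    fix \<gamma> l\<^sub>L C\<^sub>L \<delta> l\<^sub>U C\<^sub>U :: real
    assume "lower_scaling H \<gamma> l\<^sub>L C\<^sub>L \<and> upper_scaling H \<delta> l\<^sub>U C\<^sub>U \<and> \<delta> < 2"
    then have H_pos: "\<And>l. l > 0 \<Longrightarrow> H l > 0" and c: "\<gamma> > 0" "l\<^sub>L \<ge> 0" "C\<^sub>L > 0"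
      and H_lower: "\<And>l x. l > l\<^sub>L \<Longrightarrow> x \<ge> 1 \<Longrightarrow> H (l * x) / H l \<ge> C\<^sub>L * x powr \<gamma>"
      by (auto simp: lower_scaling_def)
    \<comment> \<open>Chosen so that \<open>C\<^sub>L * K powr \<gamma>\<close> is
      \<open>C\<^sub>L + 2\<close>, hence at least 2; the summand 1 ensures
      \<open>K \<ge> 1\<close>.\<close>
    define K where "K = (1 + 2 / C\<^sub>L) powr (1 / \<gamma>)"
    have K: "K \<ge> 1"
      unfolding K_def using c by (intro ge_one_powr_ge_zero) auto
    have "C\<^sub>L * K powr \<gamma> = C\<^sub>L + 2"
      using c by (simp add: K_def powr_powr field_simps)
    then have C_K: "C\<^sub>L * K powr \<gamma> \<ge> 2"
      using c by simp
    have upper: "\<phi> l \<le> (K + 1) * (l * deriv \<phi> l)" if "l > l\<^sub>L" for l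
    proof -
      have l: "l > 0" "l * K > 0"
        using that c K by (auto intro: mult_pos_pos)
      have "2 \<le> H (l * K) / H l"
        using H_lower[OF that K] C_K by linarith
      then have "2 * H l \<le> H (l * K)"
        using H_pos[OF l(1)] by (simp add: field_simps)
      moreover have "H (l * K) \<le> \<phi> (l * K)"
        using \<phi>(2)[OF l(2)] l(2) assms(4)[OF l(2)] by simp
      moreover have "\<phi> (l * K) \<le> \<phi> l + (l * K - l) * deriv \<phi> l"
        using \<phi>(4) l by blast
      \<comment> \<open>Since \<open>\<phi> l = H l + l * deriv \<phi> l\<close>, the chain reads
        \<open>2 * H l \<le> H l + K * (l * deriv \<phi> l)\<close>. Cancelling \<open>H l\<close>
        and adding \<open>l * deriv \<phi> l\<close> gives the factor \<open>K + 1\<close>.\<close>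
      ultimately show ?thesis
        using assms(4)[OF l(1)] by (simp add: algebra_simps)
    qed
    \<comment> \<open>The bound \<open>upper\<close> covers all \<open>l > l\<^sub>L\<close>, a set
      containing this range, so \<open>1/2\<close> is an arbitrary choice of \<open>M\<close>. The
      lower constant 1 expresses \<open>H l > 0\<close>.\<close>
    have "comparable_on {max l\<^sub>L (inverse (1/2) * l\<^sub>U)<..} (\<lambda>l. l * deriv \<phi> l) \<phi>"
      unfolding comparable_on_def
    proof (rule exI[of _ 1], rule conjI[OF zero_less_one], rule exI[of _ "K + 1"], intro conjI ballI)
      fix l assume "l \<in> {max l\<^sub>L (inverse (1/2) * l\<^sub>U)<..}"
      then have "l > l\<^sub>L" by simp
      then show "\<phi> l \<le> (K + 1) * (l * deriv \<phi> l)" by (rule upper)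
      have "l > 0" using \<open>l > l\<^sub>L\<close> c by simp
      then show "1 * (l * deriv \<phi> l) \<le> \<phi> l"
        using H_pos[of l] assms(4)[of l] by simp
    qed (use K in auto)
    then show "\<exists>M. 0 < M \<and> M < 1 \<and>
        comparable_on {max l\<^sub>L (inverse M * l\<^sub>U)<..} (\<lambda>l. l * deriv \<phi> l) \<phi>"
      by (intro exI[of _ "1/2"]) auto
  next
    fix l\<^sub>L :: real
    assume "l\<^sub>L \<ge> 0" and "comparable_on {l\<^sub>L<..} (\<lambda>l. l * deriv \<phi> l) \<phi>"
    then obtain c where c: "c > 0" and upper: "\<And>l. l > l\<^sub>L \<Longrightarrow> \<phi> l \<le> c * (l * deriv \<phi> l)"
      by (auto simp: comparable_on_def)
    \<comment> \<open>The reciprocal of the upper comparison constant becomes the scaling exponent,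
      with multiplicative constant 1 and the same threshold. Every \<open>t\<close> between
      \<open>l\<close> and \<open>l * x\<close> exceeds \<open>l\<^sub>L\<close>, so the comparison
      controls the logarithmic derivative on the whole interval.\<close>
    have "\<phi> (l * x) / \<phi> l \<ge> x powr (1 / c)" if l: "l > l\<^sub>L" and x: "x \<ge> 1" for l x
    proof -
      have pos: "l > 0" "l * x > 0" using l x \<open>l\<^sub>L \<ge> 0\<close> by (auto intro: mult_pos_pos)
      have "ln (\<phi> l) - ln l / c \<le> ln (\<phi> (l * x)) - ln (l * x) / c"
      proof (rule DERIV_nonneg_imp_nondecreasing[where f = "\<lambda>t. ln (\<phi> t) - ln t / c"])
        show "l \<le> l * x" using pos x by simp
        fix t assume "l \<le> t" "t \<le> l * x"
        then have t: "t > l\<^sub>L" "t > 0" using l \<open>l\<^sub>L \<ge> 0\<close> by auto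
        have "((\<lambda>t. ln (\<phi> t) - ln t / c) has_real_derivative deriv \<phi> t / \<phi> t - 1 / t / c) (at t)"
          using t \<phi>(3)[OF t(2)] \<phi>(1)[OF t(2)] c
          by (auto intro!: derivative_eq_intros simp: field_simps)
        moreover have "1 / t / c \<le> deriv \<phi> t / \<phi> t"
          using upper[OF t(1)] \<phi>(3)[OF t(2)] t c by (simp add: field_simps)
        ultimately show "\<exists>y. ((\<lambda>t. ln (\<phi> t) - ln t / c) has_real_derivative y) (at t) \<and> 0 \<le> y"
          by fastforce
      qed
      moreover have "ln (l * x) / c = ln l / c + ln x / c"
        using pos x by (simp add: ln_mult_pos add_divide_distrib)
      moreover have "ln (\<phi> (l * x) / \<phi> l) = ln (\<phi> (l * x)) - ln (\<phi> l)"
        using \<phi>(3)[OF pos(1)] \<phi>(3)[OF pos(2)] by (simp add: ln_div)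
      ultimately have "ln x / c \<le> ln (\<phi> (l * x) / \<phi> l)"
        by simp
      then have "exp (ln x / c) \<le> \<phi> (l * x) / \<phi> l"
        using \<phi>(3)[OF pos(1)] \<phi>(3)[OF pos(2)] by (simp add: ln_ge_iff)
      then show ?thesis using x by (simp add: powr_def)
    qed
    then have "lower_scaling \<phi> (1 / c) l\<^sub>L 1"
      using c \<phi>(3) \<open>l\<^sub>L \<ge> 0\<close> by (auto simp: lower_scaling_def)
    then show "\<exists>\<gamma> C\<^sub>L. lower_scaling \<phi> \<gamma> l\<^sub>L C\<^sub>L" by blast
  qed
qed

end
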